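(* For every integer $n\ge 0$, \[ \binom{2n}{n}^3 = [(xyzt)^n]\,\frac{1}{1-(x+y)(1-4zt)-z-t}= [(xyzt)^n]\,\frac{1}{\det(I-\mathrm{diag}(x,y,z,t)M)}, \] where $I$ is the $4\times 4$ identity matrix, $\mathrm{diag}(x,y,z,t)$ is the $4\times 4$ diagonal matrix with diagonal entries $x,y,z,t$ (in this order), and \[ M=\begin{bmatrix} 1 & 1 & 1 & 1\\ 1 & 1 & 1 & 1\\ 1 & 1 & 1 & -1\\ 1 & 1 & -1 & 1 \end{bmatrix}. \]
   Context: Here $x,y,z,t$ are indeterminates over $\mathbb{C}$. For a rational function $f=P/Q\in\mathbb{C}(x_1,\dots,x_m)$ with $Q(0,\dots,0)\ne 0$, $[x_1^{\alpha_1}\cdots x_m^{\alpha_m}]f$ denotes the coefficient of $x_1^{\alpha_1}\cdots x_m^{\alpha_m}$ in the Taylor (formal power) series expansion of $f$ around $(0,\dots,0)$. In particular $[(xyzt)^n]$ extracts the coefficient of $x^ny^nz^nt^n$. *)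

theory Defs
  imports
    Jordan_Normal_Form.Determinant
    "HOL-Computational_Algebra.Polynomial_Factorial"
    "HOL-Computational_Algebra.Polynomial_FPS"
begin

text \<open>
  Polynomials and formal power series in four indeterminates are iterated univariate ones,
  with \<open>x\<close> innermost and \<open>t\<close> outermost: \<open>\<complex>[x][y][z][t]\<close> and \<open>\<complex>[[x]][[y]][[z]][[t]]\<close>.
\<close>

type_synonym poly4 = "complex poly poly poly poly"
type_synonym fps4 = "complex fps fps fps fps"
type_synonym ratfun4 = "poly4 fract"

definition ind_x :: ratfun4 where "ind_x = to_fract [:[:[:[:0, 1:]:]:]:]"
definition ind_y :: ratfun4 where "ind_y = to_fract [:[:[:0, 1:]:]:]"
definition ind_z :: ratfun4 where "ind_z = to_fract [:[:0, 1:]:]"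
definition ind_t :: ratfun4 where "ind_t = to_fract [:0, 1:]"

definition eval_origin :: "poly4 \<Rightarrow> complex" where
  "eval_origin Q = poly (poly (poly (poly Q 0) 0) 0) 0"

definition fps_of_poly2 :: "complex poly poly \<Rightarrow> complex fps fps" where
  "fps_of_poly2 p = fps_of_poly (map_poly fps_of_poly p)"

definition fps_of_poly3 :: "complex poly poly poly \<Rightarrow> complex fps fps fps" where
  "fps_of_poly3 p = fps_of_poly (map_poly fps_of_poly2 p)"

definition fps_of_poly4 :: "poly4 \<Rightarrow> fps4" where
  "fps_of_poly4 p = fps_of_poly (map_poly fps_of_poly3 p)"

text \<open>
  The expansion of \<open>P / Q\<close> at the origin is the power series \<open>F\<close> with \<open>F * Q = P\<close>. It exists, is
  unique and does not depend on the representation of \<open>f\<close>, see \<open>taylor_Fract\<close> below; the value is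
  unspecified if \<open>f\<close> has no representation whose denominator is nonzero at the origin.
\<close>

definition taylor :: "ratfun4 \<Rightarrow> fps4" where
  "taylor f = (THE F. \<exists>P Q. eval_origin Q \<noteq> 0 \<and> f = Fract P Q \<and>
                            F * fps_of_poly4 Q = fps_of_poly4 P)"

text \<open>\<open>taylor_coeff a b c d f\<close> is the coefficient of \<open>x\<^sup>a y\<^sup>b z\<^sup>c t\<^sup>d\<close>.\<close>

definition taylor_coeff :: "nat \<Rightarrow> nat \<Rightarrow> nat \<Rightarrow> nat \<Rightarrow> ratfun4 \<Rightarrow> complex" where
  "taylor_coeff a b c d f = fps_nth (fps_nth (fps_nth (fps_nth (taylor f) d) c) b) a"

definition matrix_M :: "ratfun4 mat" where
  "matrix_M = mat_of_rows_list 4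
     [[1, 1,  1,  1],
      [1, 1,  1,  1],
      [1, 1,  1, -1],
      [1, 1, -1,  1]]"


lemma fps_of_map_poly_mult:
  fixes h :: "'a::comm_semiring_1 \<Rightarrow> 'b::comm_semiring_1"
  assumes h0: "h 0 = 0" and ha: "\<And>a b. h (a + b) = h a + h b"
    and hm: "\<And>a b. h (a * b) = h a * h b"
  shows "fps_of_poly (map_poly h (p * q)) = fps_of_poly (map_poly h p) * fps_of_poly (map_poly h q)"
proof -
  have hs: "h (sum g A) = (\<Sum>i\<in>A. h (g i))" for g :: "nat \<Rightarrow> 'a" and A
    by (induction A rule: infinite_finite_induct) (simp_all add: h0 ha)
  show ?thesis
    by (simp add: fps_eq_iff fps_mult_nth coeff_map_poly h0 coeff_mult hs hm atLeast0AtMost)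
qed

lemma fps_of_map_poly_add:
  assumes "h 0 = 0" "\<And>a b. h (a + b) = h a + h b"
  shows "fps_of_poly (map_poly h (p + q)) = fps_of_poly (map_poly h p) + fps_of_poly (map_poly h q)"
  using assms by (simp add: fps_eq_iff coeff_map_poly)

lemma fps_of_poly2_0: "fps_of_poly2 0 = 0"
  and fps_of_poly3_0: "fps_of_poly3 0 = 0"
  and fps_of_poly4_0: "fps_of_poly4 0 = 0"
  by (simp_all add: fps_of_poly2_def fps_of_poly3_def fps_of_poly4_def)

lemma fps_of_poly2_add: "fps_of_poly2 (p + q) = fps_of_poly2 p + fps_of_poly2 q"
  unfolding fps_of_poly2_def by (rule fps_of_map_poly_add) (simp_all add: fps_of_poly_add)

lemma fps_of_poly3_add: "fps_of_poly3 (p + q) = fps_of_poly3 p + fps_of_poly3 q"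
  unfolding fps_of_poly3_def
  by (rule fps_of_map_poly_add) (simp_all add: fps_of_poly2_0 fps_of_poly2_add)

lemma fps_of_poly2_mult: "fps_of_poly2 (p * q) = fps_of_poly2 p * fps_of_poly2 q"
  unfolding fps_of_poly2_def
  by (rule fps_of_map_poly_mult) (simp_all add: fps_of_poly_add fps_of_poly_mult)

lemma fps_of_poly3_mult: "fps_of_poly3 (p * q) = fps_of_poly3 p * fps_of_poly3 q"
  unfolding fps_of_poly3_def
  by (rule fps_of_map_poly_mult) (simp_all add: fps_of_poly2_0 fps_of_poly2_add fps_of_poly2_mult)

lemma fps_of_poly4_mult: "fps_of_poly4 (p * q) = fps_of_poly4 p * fps_of_poly4 q"
  unfolding fps_of_poly4_def
  by (rule fps_of_map_poly_mult) (simp_all add: fps_of_poly3_0 fps_of_poly3_add fps_of_poly3_mult)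

lemma fps_dvd_one: 
  fixes f :: "'a::comm_ring_1 fps"
  assumes "fps_nth f 0 dvd 1"
  shows "f dvd 1"
proof -
  from assms obtain y where "fps_nth f 0 * y = 1" by (metis dvdE)
  then have "f * fps_right_inverse f y = 1" by (rule fps_right_inverse)
  then show ?thesis by (metis dvd_triv_left)
qed

lemma fps_of_poly4_dvd_one:
  assumes "eval_origin Q \<noteq> 0"
  shows "fps_of_poly4 Q dvd 1"
  using assms
  by (auto intro!: fps_dvd_one
      simp: fps_of_poly4_def fps_of_poly3_def fps_of_poly2_def coeff_map_poly fps_of_poly2_0
        fps_of_poly3_0 eval_origin_def poly_0_coeff_0 dvd_field_iff)

lemma taylor_Fract:
  assumes Q: "eval_origin Q \<noteq> 0" and F: "F * fps_of_poly4 Q = fps_of_poly4 P"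
  shows "taylor (Fract P Q) = F"
  unfolding taylor_def
proof (rule the_equality)
  show "\<exists>P' Q'. eval_origin Q' \<noteq> 0 \<and> Fract P Q = Fract P' Q' \<and>
          F * fps_of_poly4 Q' = fps_of_poly4 P'"
    using assms by blast
next
  fix G assume "\<exists>P' Q'. eval_origin Q' \<noteq> 0 \<and> Fract P Q = Fract P' Q' \<and>
          G * fps_of_poly4 Q' = fps_of_poly4 P'"
  then obtain P' Q' where Q': "eval_origin Q' \<noteq> 0" and eq: "Fract P Q = Fract P' Q'"
    and G: "G * fps_of_poly4 Q' = fps_of_poly4 P'" by blast
  have "Q \<noteq> 0" "Q' \<noteq> 0" using Q Q' by (auto simp: eval_origin_def)
  with eq have "P * Q' = P' * Q" by (simp add: eq_fract)
  then have "fps_of_poly4 P * fps_of_poly4 Q' = fps_of_poly4 P' * fps_of_poly4 Q"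
    by (metis fps_of_poly4_mult)
  then have "F * (fps_of_poly4 Q * fps_of_poly4 Q') = G * (fps_of_poly4 Q * fps_of_poly4 Q')"
    by (simp add: F [symmetric] G [symmetric] ac_simps)
  moreover have "fps_of_poly4 Q \<noteq> 0" "fps_of_poly4 Q' \<noteq> 0"
    using fps_of_poly4_dvd_one [OF Q] fps_of_poly4_dvd_one [OF Q'] by auto
  ultimately show "G = F" by simp
qed

lemma taylor_Fract_mult:
  assumes "eval_origin Q \<noteq> 0"
  shows "taylor (Fract P Q) * fps_of_poly4 Q = fps_of_poly4 P"
proof -
  obtain u where "fps_of_poly4 Q * u = 1"
    using fps_of_poly4_dvd_one [OF assms] by (metis dvdE)
  then have "(fps_of_poly4 P * u) * fps_of_poly4 Q = fps_of_poly4 P"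
    by (simp add: mult.assoc mult.commute [of u])
  with taylor_Fract [OF assms this] show ?thesis by simp
qed

end

theory Submission
  imports Defs
begin

text \<open>
  The principal minors of the matrix show that both rational functions are the same: those
  of order two and the one of order four vanish, and among those of order three only the ones
  on \<open>{x, z, t}\<close> and \<open>{y, z, t}\<close> are nonzero, with value \<open>-4\<close>. Hence the determinant is
  \<open>1 - x - y - z - t + 4xzt + 4yzt\<close> (\<open>det_one_minus_diag_mult\<close>).

  Expanding \<open>1 / (1 - z - t - (x + y)(1 - 4zt))\<close> as a geometric series in \<open>x + y\<close> shows that the
  coefficient of \<open>x\<^sup>a y\<^sup>b\<close> is \<open>(a + b choose a) S\<^sub>a\<^sub>+\<^sub>b\<close> with
  \<open>S\<^sub>m = (1 - 4zt)\<^sup>m / (1 - z - t)\<^sup>m\<^sup>+\<^sup>1\<close>. In the proof this is verified in the other direction: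
  the series with these coefficients is multiplied by the denominator and gives \<open>1\<close>, because of
  Pascal's rule and \<open>(1 - z - t) S\<^sub>m\<^sub>+\<^sub>1 = (1 - 4zt) S\<^sub>m\<close> (\<open>expansion_mult_denominator\<close>).

  It remains to see that the coefficient of \<open>z\<^sup>n t\<^sup>n\<close> in \<open>S\<^sub>2\<^sub>n\<close> is \<open>(2n choose n)\<^sup>2\<close>
  (\<open>slice_diagonal_central\<close>). The binomial theorem for \<open>(1 - 4zt)\<^sup>2\<^sup>n\<close> turns it into
  \[ \sum_k \binom{2n}{k} (-4)^k \binom{4n-2k}{2n} \binom{2n-2k}{n-k}. \]
  By the duplication formula \<open>(2m)! = 4\<^sup>m (1/2)\<^sub>m m!\<close> for the rising factorial
  \<open>(1/2)\<^sub>m\<close>, the summand for \<open>k = n - j\<close> is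
  \<open>(-4)\<^sup>n (2n choose n) (-1/2 - n choose j) (n choose n - j)\<close>, so that the sum is
  \<open>(-4)\<^sup>n (2n choose n) (-1/2 choose n) = (2n choose n)\<^sup>2\<close> by Vandermonde's convolution.
\<close>

no_notation vec_index (infixl "$" 100)
unbundle fps_syntax


section \<open>The determinant\<close>

text \<open>Laplace expansion along row \<open>0\<close>, as a rewrite rule for matrices given by their entries.\<close>

lemma det_mat_Suc:
  fixes f :: "nat \<times> nat \<Rightarrow> 'a :: comm_ring_1"
  shows "det (mat (Suc n) (Suc n) f) =
    (\<Sum>j<Suc n. f (0, j) *
       ((-1) ^ j * det (mat n n (\<lambda>(i, k). f (Suc i, if k < j then k else Suc k)))))"
proof -
  have "mat_delete (mat (Suc n) (Suc n) f) 0 j =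
          mat n n (\<lambda>(i, k). f (Suc i, if k < j then k else Suc k))"
    if "j < Suc n" for j
    using that by (intro eq_matI) (auto simp: mat_delete_def)
  then show ?thesis
    by (subst laplace_expansion_row[of _ "Suc n" 0]) (auto simp: cofactor_def intro!: sum.cong)
qed

lemma det_one_minus_diag_mult:
  fixes x y z t :: "'a :: comm_ring_1"
  defines "M \<equiv> mat_of_rows_list 4 [[1, 1, 1, 1], [1, 1, 1, 1], [1, 1, 1, -1], [1, 1, -1, 1]]"
  shows "det (1\<^sub>m 4 - mat_diag 4 (\<lambda>i. [x, y, z, t] ! i) * M) =
     1 - (x + y) * (1 - 4 * z * t) - z - t"
proof -
  have M: "M \<in> carrier_mat 4 4"
    unfolding carrier_mat_def by (simp add: M_def mat_of_rows_list_def)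
  let ?f = "\<lambda>(i, j). [[1 - x, -x, -x, -x], [-y, 1 - y, -y, -y],
                      [-z, -z, 1 - z, z], [-t, -t, t, 1 - t]] ! i ! j"
  have "1\<^sub>m 4 - mat_diag 4 (\<lambda>i. [x, y, z, t] ! i) * M = mat (Suc 3) (Suc 3) ?f"
    unfolding mat_diag_mult_left[OF M]
    by (rule eq_matI) (auto simp: M_def mat_of_rows_list_def less_Suc_eq numeral_eq_Suc)
  also have "det \<dots> = 1 - (x + y) * (1 - 4 * z * t) - z - t"
    by (simp add: det_mat_Suc numeral_eq_Suc) (simp add: algebra_simps)
  finally show ?thesis .
qed


section \<open>Passing to formal power series\<close>

text \<open>The indeterminates as polynomials and as power series, matching \<open>ind_x\<close> to \<open>ind_t\<close>.\<close>

abbreviation poly_x :: poly4 where "poly_x \<equiv> [:[:[:[:0, 1:]:]:]:]"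
abbreviation poly_y :: poly4 where "poly_y \<equiv> [:[:[:0, 1:]:]:]"
abbreviation poly_z :: poly4 where "poly_z \<equiv> [:[:0, 1:]:]"
abbreviation poly_t :: poly4 where "poly_t \<equiv> [:0, 1:]"

abbreviation series_x :: fps4 where "series_x \<equiv> fps_const (fps_const (fps_const fps_X))"
abbreviation series_y :: fps4 where "series_y \<equiv> fps_const (fps_const fps_X)"
abbreviation series_z :: fps4 where "series_z \<equiv> fps_const fps_X"
abbreviation series_t :: fps4 where "series_t \<equiv> fps_X"

text \<open>
  The arithmetic of \<open>pCons\<close> is switched off below wherever the arithmetic expression
  \<open>denominator\<close> is to be translated operation by operation.
\<close>

abbreviation denominator :: poly4 where
  "denominator \<equiv> 1 - (poly_x + poly_y) * (1 - 4 * poly_z * poly_t) - poly_z - poly_t"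

lemma fps_of_poly4_add: "fps_of_poly4 (p + q) = fps_of_poly4 p + fps_of_poly4 q"
  unfolding fps_of_poly4_def
  by (rule fps_of_map_poly_add) (simp_all add: fps_of_poly3_0 fps_of_poly3_add)

lemma fps_of_poly4_diff: "fps_of_poly4 (p - q) = fps_of_poly4 p - fps_of_poly4 q"
  using fps_of_poly4_add[of "p - q" q] by simp

lemma fps_of_poly2_1: "fps_of_poly2 1 = 1"
  and fps_of_poly3_1: "fps_of_poly3 1 = 1"
  and fps_of_poly4_1: "fps_of_poly4 1 = 1"
  by (simp_all add: fps_of_poly2_def fps_of_poly3_def fps_of_poly4_def map_poly_1)

lemma fps_of_poly4_numeral: "fps_of_poly4 (numeral k) = numeral k"
  by (induction k) (simp_all only: numeral.simps fps_of_poly4_add fps_of_poly4_1)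

lemma fps_of_poly4_ind:
  "fps_of_poly4 poly_x = series_x"
  "fps_of_poly4 poly_y = series_y"
  "fps_of_poly4 poly_z = series_z"
  "fps_of_poly4 poly_t = series_t"
  by (simp_all add: fps_of_poly2_def fps_of_poly3_def fps_of_poly4_def map_poly_pCons map_poly_1
      fps_of_poly_pCons fps_of_poly2_1 fps_of_poly3_1)

lemma to_fract_numeral: "to_fract (numeral k :: 'a :: idom) = numeral k"
  by (induction k) (simp_all only: numeral.simps to_fract_add to_fract_1)

lemma rational_function_eq_Fract:
  "1 / (1 - (ind_x + ind_y) * (1 - 4 * ind_z * ind_t) - ind_z - ind_t) = Fract 1 denominator"
  by (simp add: Fract_conv_to_fract ind_x_def ind_y_def ind_z_def ind_t_def to_fract_numeral
      del: mult_pCons_left mult_pCons_right add_pCons diff_pCons)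

lemma eval_origin_denominator: "eval_origin denominator \<noteq> 0"
  by (simp add: eval_origin_def)

lemma fps_of_poly4_denominator:
  "fps_of_poly4 denominator =
     1 - (series_x + series_y) * (1 - 4 * series_z * series_t) - series_z - series_t"
  by (simp add: fps_of_poly4_add fps_of_poly4_diff fps_of_poly4_mult fps_of_poly4_1
      fps_of_poly4_numeral fps_of_poly4_ind
      del: mult_pCons_left mult_pCons_right add_pCons diff_pCons)

lemma numeral_mult_fps_nth: "(numeral k * f) $ n = numeral k * (f $ n :: 'a :: comm_ring_1)"
  by (simp add: fps_numeral_fps_const)


section \<open>Powers of $1/(1-z-t)$\<close>

text \<open>
  The series \<open>1 / (1 - z - t)\<^sup>m\<^sup>+\<^sup>1\<close>, where \<open>z\<close> is the inner and \<open>t\<close> the outer indeterminate. The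
  coefficient of \<open>z\<^sup>c t\<^sup>d\<close> is the trinomial coefficient \<open>(m + c + d)! / (m! c! d!)\<close>.
\<close>

definition neg_power :: "nat \<Rightarrow> complex fps fps" where
  "neg_power m = Abs_fps (\<lambda>d. Abs_fps (\<lambda>c. of_nat ((m + c + d choose m) * (c + d choose c))))"

lemma neg_power_nth [simp]:
  "neg_power m $ d $ c = of_nat ((m + c + d choose m) * (c + d choose c))"
  by (simp add: neg_power_def)

lemma neg_power_0: "(1 - fps_const fps_X - fps_X) * neg_power 0 = 1"
proof -
  have "((1 - fps_const fps_X - fps_X) * neg_power 0) $ d $ c = (1 :: complex fps fps) $ d $ c"
    for c d
    by (cases c; cases d) (simp_all add: algebra_simps)
  then show ?thesis by (simp add: fps_eq_iff)
qed

text \<open>Pascal's rule for trinomial coefficients, with \<open>s\<close> in the role of \<open>c + d\<close>.\<close>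

lemma trinomial_Pascal:
  "(Suc m + s choose Suc m) * (s choose c) =
     (m + s choose m) * (s choose c) +
     (if s = 0 then 0 else (m + s choose Suc m) *
        ((s - 1 choose c) + (if c = 0 then 0 else s - 1 choose (c - 1))))"
  by (cases s; cases c) (simp_all add: algebra_simps)

lemma neg_power_Suc: "(1 - fps_const fps_X - fps_X) * neg_power (Suc m) = neg_power m"
proof -
  have "((1 - fps_const fps_X - fps_X) * neg_power (Suc m)) $ d $ c = neg_power m $ d $ c" for c d
  proof -
    have "of_nat ((Suc m + c + d choose Suc m) * (c + d choose c)) =
      (of_nat ((m + c + d choose m) * (c + d choose c) +
         (if c + d = 0 then 0 else (m + c + d choose Suc m) *
            ((c + d - 1 choose c) + (if c = 0 then 0 else c + d - 1 choose (c - 1))))) :: complex)"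
      using trinomial_Pascal[of m "c + d" c] by (simp only: add.assoc)
    then show ?thesis
      by (cases c; cases d) (simp_all add: algebra_simps)
  qed
  then show ?thesis by (simp add: fps_eq_iff)
qed


section \<open>The expansion of the rational function\<close>

text \<open>
  The series \<open>(1 - 4zt)\<^sup>m / (1 - z - t)\<^sup>m\<^sup>+\<^sup>1\<close>, which is the coefficient of \<open>(x + y)\<^sup>m\<close> in
  the expansion of the rational function.
\<close>

definition slice :: "nat \<Rightarrow> complex fps fps" where
  "slice m = (1 - 4 * fps_const fps_X * fps_X) ^ m * neg_power m"

lemma slice_0: "(1 - fps_const fps_X - fps_X) * slice 0 = 1"
  by (simp add: slice_def neg_power_0)

lemma slice_Suc:
  "(1 - fps_const fps_X - fps_X) * slice (Suc m) =
     slice m - 4 * (fps_const fps_X * (fps_X * slice m))"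
proof -
  let ?D = "1 - fps_const fps_X - fps_X :: complex fps fps"
  let ?P = "1 - 4 * fps_const fps_X * fps_X :: complex fps fps"
  have "?D * slice (Suc m) = ?P * (?P ^ m * (?D * neg_power (Suc m)))"
    unfolding slice_def power_Suc by (simp only: ac_simps)
  also have "\<dots> = ?P * slice m"
    unfolding neg_power_Suc slice_def ..
  also have "\<dots> = slice m - 4 * (fps_const fps_X * (fps_X * slice m))"
    by (simp add: left_diff_distrib mult.assoc)
  finally show ?thesis .
qed

text \<open>
  The power series expansion of the rational function, given by its coefficients. Coefficients
  are extracted from the outermost indeterminate inwards, that is, in the order \<open>t\<close>, \<open>z\<close>, \<open>y\<close>,
  \<open>x\<close>.
\<close>

definition expansion :: fps4 where
  "expansion = Abs_fps (\<lambda>d. Abs_fps (\<lambda>c. Abs_fps (\<lambda>b. Abs_fps (\<lambda>a.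
     of_nat (a + b choose a) * slice (a + b) $ d $ c))))"

lemma expansion_nth [simp]:
  "expansion $ d $ c $ b $ a = of_nat (a + b choose a) * slice (a + b) $ d $ c"
  by (simp add: expansion_def)

lemma expansion_mult_denominator: "expansion * fps_of_poly4 denominator = 1"
proof -
  let ?S = "\<lambda>m d c. slice m $ d $ c"
  \<comment> \<open>the coefficients of \<open>(1 - z - t) S\<^sub>m\<close> and \<open>(1 - 4zt) S\<^sub>m\<close>\<close>
  let ?L = "\<lambda>m d c. ?S m d c - (if c = 0 then 0 else ?S m d (c - 1))
                              - (if d = 0 then 0 else ?S m (d - 1) c)"
  let ?R = "\<lambda>m d c. ?S m d c - 4 * (if c = 0 \<or> d = 0 then 0 else ?S m (d - 1) (c - 1))"
  have L_0: "?L 0 d c = (if c = 0 \<and> d = 0 then 1 else 0)" for c d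
    using arg_cong[OF slice_0, of "\<lambda>f. f $ d $ c"] by (simp add: algebra_simps split: if_splits)
  have L_Suc: "?L (Suc m) d c = ?R m d c" for m c d
    using arg_cong[OF slice_Suc, of "\<lambda>f. f $ d $ c" m]
    by (simp add: left_diff_distrib numeral_mult_fps_nth split: if_splits)
  have product: "expansion * fps_of_poly4 denominator =
     expansion - series_z * expansion - series_t * expansion
       - series_x * (expansion - 4 * (series_z * (series_t * expansion)))
       - series_y * (expansion - 4 * (series_z * (series_t * expansion)))"
    unfolding fps_of_poly4_denominator by (simp add: algebra_simps del: fps_const_add)
  have "(expansion * fps_of_poly4 denominator) $ d $ c $ b $ a = (1 :: fps4) $ d $ c $ b $ a"
    for a b c d
  proof -
    have "(expansion * fps_of_poly4 denominator) $ d $ c $ b $ a =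
      of_nat (a + b choose a) * ?L (a + b) d c
       - (if a = 0 then 0 else of_nat (a - 1 + b choose (a - 1)) * ?R (a - 1 + b) d c)
       - (if b = 0 then 0 else of_nat (a + (b - 1) choose a) * ?R (a + (b - 1)) d c)"
      unfolding product by (simp add: numeral_mult_fps_nth) (simp add: algebra_simps)
    also have "\<dots> = (1 :: fps4) $ d $ c $ b $ a"
    proof (cases "a + b")
      case 0
      then show ?thesis using L_0[of d c] by (cases c; cases d) simp_all
    next
      case (Suc m)
      show ?thesis
        unfolding Suc L_Suc using Suc by (cases a; cases b) (auto simp: algebra_simps)
    qed
    finally show ?thesis .
  qed
  then show ?thesis by (simp add: fps_eq_iff)
qed

lemma taylor_rational_function:
  "taylor (1 / (1 - (ind_x + ind_y) * (1 - 4 * ind_z * ind_t) - ind_z - ind_t)) = expansion"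
  unfolding rational_function_eq_Fract
  by (rule taylor_Fract[OF eval_origin_denominator])
     (simp only: expansion_mult_denominator fps_of_poly4_1)


section \<open>The diagonal coefficients\<close>

lemma slice_diagonal:
  "slice m $ n $ n = (\<Sum>k\<le>n. of_nat (m choose k) * (- 4) ^ k *
     of_nat ((m + 2 * (n - k) choose m) * (2 * (n - k) choose (n - k))))"
proof -
  let ?f = "\<lambda>k. of_nat (m choose k) * (- 4) ^ k *
     (if k \<le> n then of_nat ((m + 2 * (n - k) choose m) * (2 * (n - k) choose (n - k))) else 0)
       :: complex"
  let ?w = "fps_const fps_X * fps_X :: complex fps fps"
  have power: "(-4 * ?w) ^ k = (-4) ^ k * (fps_const (fps_X ^ k) * fps_X ^ k)" for k
    by (simp only: power_mult_distrib fps_const_power)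
  have "1 - 4 * fps_const fps_X * fps_X = -4 * ?w + 1"
    by simp
  then have "(1 - 4 * fps_const fps_X * fps_X :: complex fps fps) ^ m =
     (\<Sum>k\<le>m. of_nat (m choose k) * ((-4) ^ k * (fps_const (fps_X ^ k) * fps_X ^ k)))"
    by (simp only: binomial_ring power power_one mult_1_right)
  then have "slice m = (\<Sum>k\<le>m. fps_const (fps_const (of_nat (m choose k) * (-4) ^ k)) *
      (fps_const (fps_X ^ k) * (fps_X ^ k * neg_power m)))"
    by (simp add: slice_def sum_distrib_right fps_of_nat[symmetric] fps_numeral_fps_const
        mult.assoc flip: fps_const_mult)
  then have "slice m $ n $ n = (\<Sum>k\<le>m. ?f k)"
    by (auto simp: fps_sum_nth fps_X_power_mult_nth add.assoc mult_2 [symmetric]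
        diff_mult_distrib2 intro!: sum.cong)
  \<comment> \<open>the terms with \<open>k > m\<close> or \<open>k > n\<close> vanish\<close>
  also have "\<dots> = (\<Sum>k\<le>m+n. ?f k)"
    by (rule sum.mono_neutral_left) auto
  also have "\<dots> = (\<Sum>k\<le>n. ?f k)"
    by (rule sum.mono_neutral_right) auto
  also have "\<dots> = (\<Sum>k\<le>n. of_nat (m choose k) * (- 4) ^ k *
      of_nat ((m + 2 * (n - k) choose m) * (2 * (n - k) choose (n - k))))"
    by (rule sum.cong) simp_all
  finally show ?thesis .
qed

lemma central_binomial_gbinomial:
  "of_nat (2 * n choose n) = (-4) ^ n * ((-1/2 :: 'a :: field_char_0) gchoose n)"
proof -
  have "of_nat (2 * n choose n) = (fact (2 * n) / (fact n * fact n) :: 'a)"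
    by (simp add: binomial_fact mult_2)
  also have "\<dots> = 4 ^ n * pochhammer (1/2) n / fact n"
    by (simp add: fact_double power_mult)
  finally show ?thesis
    by (simp add: gbinomial_pochhammer flip: power_mult_distrib)
qed

text \<open>
  The summand in \<open>slice_diagonal\<close> for \<open>m = 2n\<close> and \<open>k = n - j\<close> as a summand of Vandermonde's
  convolution. The factor \<open>(4n - 2k)!\<close> is rewritten with the duplication formula and
  \<open>(1/2)\<^sub>n\<^sub>+\<^sub>j = (1/2)\<^sub>n (1/2 + n)\<^sub>j\<close>.
\<close>

lemma diagonal_summand_eq:
  assumes "j \<le> n"
  shows "of_nat (2 * n choose (n - j)) * (- 4) ^ (n - j) *
     of_nat ((2 * n + 2 * j choose (2 * n)) * (2 * j choose j)) =
     (-4) ^ n * of_nat (2 * n choose n) *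
      (((-1/2 - of_nat n) gchoose j) * (of_nat (n choose (n - j)) :: 'a :: field_char_0))"
proof -
  have double: "fact (2 * m) = 4 ^ m * pochhammer (1/2::'a) m * fact m" for m
    by (simp only: fact_double power_mult) simp
  have split: "pochhammer (1/2::'a) (n + j) = pochhammer (1/2) n * pochhammer (1/2 + of_nat n) j"
    by (rule pochhammer_product')
  have b1: "of_nat (2 * n choose (n - j)) = (fact (2 * n) / (fact (n - j) * fact (n + j)) :: 'a)"
    using assms by (simp add: binomial_fact)
  have b2: "of_nat (2 * n + 2 * j choose (2 * n)) =
      (fact (2 * (n + j)) / (fact (2 * n) * fact (2 * j)) :: 'a)"
    by (simp add: binomial_fact distrib_left)
  have b3: "of_nat (2 * m choose m) = (fact (2 * m) / (fact m * fact m) :: 'a)" for m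
    by (simp add: binomial_fact mult_2)
  have b4: "of_nat (n choose (n - j)) = (fact n / (fact (n - j) * fact j) :: 'a)"
    using assms by (simp add: binomial_fact)
  have b5: "((-1/2 - of_nat n :: 'a) gchoose j) =
      (-1) ^ j * pochhammer (1/2 + of_nat n) j / fact j"
    by (simp add: gbinomial_pochhammer add.commute)
  have sign: "(-4 :: 'a) ^ (n - j) * 4 ^ j = (-4) ^ n * (-1) ^ j"
  proof -
    have "(-4 :: 'a) ^ n = (-4) ^ (n - j) * (-4) ^ j"
      using assms by (simp flip: power_add)
    then show ?thesis by (simp add: mult.assoc flip: power_mult_distrib)
  qed
  have "of_nat (2 * n choose (n - j)) * (- 4) ^ (n - j) *
     of_nat ((2 * n + 2 * j choose (2 * n)) * (2 * j choose j)) =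
     ((-4 :: 'a) ^ (n - j) * 4 ^ j) *
       (4 ^ n * pochhammer (1/2) n * pochhammer (1/2 + of_nat n) j) /
       (fact (n - j) * fact j * fact j)"
    unfolding of_nat_mult b1 b2 b3 double[of "n + j"] split by (simp add: power_add mult_ac)
  also have "\<dots> = (-4) ^ n * of_nat (2 * n choose n) *
      (((-1/2 - of_nat n) gchoose j) * of_nat (n choose (n - j)))"
    unfolding sign b3 b4 b5 double[of n] by (simp add: mult_ac)
  finally show ?thesis .
qed

lemma slice_diagonal_central: "slice (2 * n) $ n $ n = of_nat (2 * n choose n) ^ 2"
proof -
  let ?f = "\<lambda>k. of_nat (2 * n choose k) * (- 4) ^ k *
     of_nat ((2 * n + 2 * (n - k) choose (2 * n)) * (2 * (n - k) choose (n - k))) :: complex"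
  have "slice (2 * n) $ n $ n = (\<Sum>k\<in>{0..n}. ?f k)"
    by (simp add: slice_diagonal atLeast0AtMost)
  also have "\<dots> = (\<Sum>j\<in>{0..n}. ?f (n - j))"
    by (subst sum.atLeastAtMost_rev) simp
  also have "\<dots> = (\<Sum>j\<in>{0..n}. (-4) ^ n * of_nat (2 * n choose n) *
      (((-1/2 - of_nat n) gchoose j) * (of_nat n gchoose (n - j))))"
    by (rule sum.cong)
       (simp_all only: atLeastAtMost_iff diff_diff_cancel diagonal_summand_eq
          binomial_gbinomial [symmetric])
  also have "\<dots> = of_nat (2 * n choose n) * ((-4) ^ n * ((-1/2) gchoose n))"
    using gbinomial_Vandermonde[of "-1/2 - of_nat n :: complex" "of_nat n" n]
    by (simp flip: sum_distrib_left)
  finally show ?thesis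
    by (simp only: central_binomial_gbinomial [symmetric] power2_eq_square)
qed

theorem theorem4p3:
  fixes n :: nat
  shows "of_nat ((2 * n) choose n) ^ 3
           = taylor_coeff n n n n
               (1 / (1 - (ind_x + ind_y) * (1 - 4 * ind_z * ind_t) - ind_z - ind_t))
       \<and> taylor_coeff n n n n
               (1 / (1 - (ind_x + ind_y) * (1 - 4 * ind_z * ind_t) - ind_z - ind_t))
           = taylor_coeff n n n n
               (1 / det (1\<^sub>m 4 - mat_diag 4 (\<lambda>i. [ind_x, ind_y, ind_z, ind_t] ! i) * matrix_M))"
proof
  have "expansion $ n $ n $ n $ n = of_nat ((2 * n) choose n) ^ 3"
    using slice_diagonal_central[of n]
    by (simp add: power2_eq_square power3_eq_cube flip: mult_2)
  then show "of_nat ((2 * n) choose n) ^ 3 = taylor_coeff n n n n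
      (1 / (1 - (ind_x + ind_y) * (1 - 4 * ind_z * ind_t) - ind_z - ind_t))"
    by (simp only: taylor_coeff_def taylor_rational_function)
qed (simp only: matrix_M_def det_one_minus_diag_mult)

end
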